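(* Let $\Pi$ be a finite set of constraints in the variables $x_1,\dots,x_i$, let $\Pi_i=\Pi$, and let $\Pi_{i-1}$ be the set of constraints obtained from $\Pi_i$ by eliminating $x_i$ as defined in the context. Then $\Pi_i$ and $\Pi_{i-1}$ are equisatisfiable, and each assignment to the variables $x_1,\dots,x_{i-1}$ satisfying $\Pi_{i-1}$ can be extended (by a value for $x_i$) in order to satisfy $\Pi_i$.
   Context: Constraints. Variables range over $\mathbb{R}$. A linear inequality is an expression $\sum_k w_k x_k + b\ge 0$ with $w_k,b\in\mathbb{R}$; $x_i$ occurs positively in it if $w_i>0$, negatively if $w_i<0$, and does not occur in it if $w_i=0$. When writing an inequality as $w_ix_i+\varphi\ge 0$ it is understood that $w_i\ne 0$ and that $\varphi=\sum_{k\neq i}w_kx_k+b$ does not contain $x_i$. A constraint is a finite disjunction of linear inequalities. An assignment of real values to the variables satisfies a constraint if it satisfies at least one of its linear inequalities, and satisfies a set of constraints if it satisfies every constraint in it. A set of constraints is satisfiable if some assignment satisfies it; two sets are equisatisfiable if either both or neither are satisfiable. CP resolution. Let $\Psi=\bigvee_{k=1}^n(w_kx_i+\varphi_k\ge0)\vee\Phi$ and $\Psi'=\bigvee_{j=1}^m(w'_jx_i+\varphi'_j\ge0)\vee\Phi'$ with $m,n\ge1$, $w'_1,\dots,w'_m<0<w_1,\dots,w_n$, where $\Phi$ contains no positive occurrence of $x_i$ and $\Phi'$ contains no negative occurrence of $x_i$ ($\Phi,\Phi'$ are possibly empty disjunctions of linear inequalities). Then $$\mathrm{CPres}_i(\Psi,\Psi')=\bigvee_{j=1}^m\bigvee_{k=1}^n\left(\frac{\varphi_k}{w_k}-\frac{\varphi'_j}{w'_j}\ge0\right)\vee\Phi\vee\Phi'.$$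 Elimination of $x_i$. Let $\Pi_i^+$ be the set of constraints in $\Pi_i$ with positive and without negative occurrences of $x_i$; $\Pi_i^-$ the set of those with negative and without positive occurrences of $x_i$; $\Pi_i^{\pm}$ the set of those with both positive and negative occurrences of $x_i$. Let $\Pi_i^0=\Pi_i^+$, $\Pi_i^{k+1}=\{\mathrm{CPres}_i(\Psi,\Psi')\mid\Psi\in\Pi_i^k,\ \Psi'\in\Pi_i^\pm\}$, and $\Pi_i^{++}=\bigcup_{k=0}^{|\Pi_i^\pm|}\Pi_i^k$. Define $$\Pi_{i-1}=\bigl(\Pi_i\setminus(\Pi_i^+\cup\Pi_i^-\cup\Pi_i^\pm)\bigr)\cup\{\mathrm{CPres}_i(\Psi,\Psi')\mid\Psi\in\Pi_i^{++},\ \Psi'\in\Pi_i^-\}.$$ The variable $x_i$ does not occur in $\Pi_{i-1}$. *)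

theory Defs
  imports Complex_Main "HOL-Library.FSet" "HOL-Library.Poly_Mapping"
begin

section \<open>Constraints\<close>

text \<open>
  The linear inequality \<open>\<Sum>k. w k * x k + b \<ge> 0\<close> is represented by its left-hand side
  \<open>Lin w b\<close>.  A constraint is the finite set of its disjuncts, that is, a finite disjunction
  up to order and repetition.
\<close>

datatype lin = Lin (weights: "nat \<Rightarrow>\<^sub>0 real") (offset: real)

type_synonym constraint = "lin fset"

text \<open>
  Assignments are total functions.  Only the values of the variables that occur matter, see
  \<open>satisfies_cong\<close> below, so an assignment to a set of variables is a total function
  whose values elsewhere are irrelevant.
\<close>

type_synonym assignment = "nat \<Rightarrow> real"

abbreviation weight :: "lin \<Rightarrow> nat \<Rightarrow> real" where
  "weight e \<equiv> Poly_Mapping.lookup (weights e)"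

definition lin_value :: "assignment \<Rightarrow> lin \<Rightarrow> real" where
  "lin_value \<alpha> e = (\<Sum>k\<in>Poly_Mapping.keys (weights e). weight e k * \<alpha> k) + offset e"

definition satisfies_constraint :: "assignment \<Rightarrow> constraint \<Rightarrow> bool" where
  "satisfies_constraint \<alpha> \<Psi> \<longleftrightarrow> (\<exists>e. e |\<in>| \<Psi> \<and> lin_value \<alpha> e \<ge> 0)"

definition satisfies :: "assignment \<Rightarrow> constraint set \<Rightarrow> bool" where
  "satisfies \<alpha> C \<longleftrightarrow> (\<forall>\<Psi>\<in>C. satisfies_constraint \<alpha> \<Psi>)"

definition satisfiable :: "constraint set \<Rightarrow> bool" where
  "satisfiable C \<longleftrightarrow> (\<exists>\<alpha>. satisfies \<alpha> C)"

definition equisatisfiable :: "constraint set \<Rightarrow> constraint set \<Rightarrow> bool" where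
  "equisatisfiable C D \<longleftrightarrow> (satisfiable C \<longleftrightarrow> satisfiable D)"

definition occurs_pos :: "nat \<Rightarrow> lin \<Rightarrow> bool" where
  "occurs_pos i e \<longleftrightarrow> weight e i > 0"

definition occurs_neg :: "nat \<Rightarrow> lin \<Rightarrow> bool" where
  "occurs_neg i e \<longleftrightarrow> weight e i < 0"

definition has_pos :: "nat \<Rightarrow> constraint \<Rightarrow> bool" where
  "has_pos i \<Psi> \<longleftrightarrow> (\<exists>e. e |\<in>| \<Psi> \<and> occurs_pos i e)"

definition has_neg :: "nat \<Rightarrow> constraint \<Rightarrow> bool" where
  "has_neg i \<Psi> \<longleftrightarrow> (\<exists>e. e |\<in>| \<Psi> \<and> occurs_neg i e)"

definition vars :: "constraint \<Rightarrow> nat set" where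
  "vars \<Psi> = {k. \<exists>e. e |\<in>| \<Psi> \<and> weight e k \<noteq> 0}"


section \<open>CP resolution\<close>

text \<open>The expression \<open>\<phi>\<close> in \<open>w\<^sub>i * x\<^sub>i + \<phi> \<ge> 0\<close>.\<close>

definition rest :: "nat \<Rightarrow> lin \<Rightarrow> lin" where
  "rest i e = Lin (Poly_Mapping.update i 0 (weights e)) (offset e)"

definition lin_div :: "lin \<Rightarrow> real \<Rightarrow> lin" where
  "lin_div e c = Lin (Poly_Mapping.map (\<lambda>a. a / c) (weights e)) (offset e / c)"

definition lin_minus :: "lin \<Rightarrow> lin \<Rightarrow> lin" where
  "lin_minus e e' = Lin (weights e - weights e') (offset e - offset e')"

text \<open>
  The requirements on \<open>\<Phi>\<close> and \<open>\<Phi>'\<close> make the decompositions of \<open>\<Psi>\<close> and \<open>\<Psi>'\<close>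
  unique: the first parts consist of all disjuncts with a positive (respectively negative)
  occurrence of \<open>x\<^sub>i\<close>, and \<open>\<Phi>\<close> and \<open>\<Phi>'\<close> of all others.  CP resolution is meant for
  \<open>has_pos i \<Psi>\<close> and \<open>has_neg i \<Psi>'\<close> only, which holds wherever it is used below.
\<close>

definition CPres :: "nat \<Rightarrow> constraint \<Rightarrow> constraint \<Rightarrow> constraint" where
  "CPres i \<Psi> \<Psi>' =
     ffUnion ((\<lambda>e'. (\<lambda>e. lin_minus (lin_div (rest i e) (weight e i))
                                  (lin_div (rest i e') (weight e' i)))
                    |`| ffilter (occurs_pos i) \<Psi>)
              |`| ffilter (occurs_neg i) \<Psi>')
     |\<union>| ffilter (\<lambda>e. \<not> occurs_pos i e) \<Psi>
     |\<union>| ffilter (\<lambda>e. \<not> occurs_neg i e) \<Psi>'"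


section \<open>Elimination of a variable\<close>

definition pos_part :: "nat \<Rightarrow> constraint set \<Rightarrow> constraint set" where
  "pos_part i C = {\<Psi>\<in>C. has_pos i \<Psi> \<and> \<not> has_neg i \<Psi>}"

definition neg_part :: "nat \<Rightarrow> constraint set \<Rightarrow> constraint set" where
  "neg_part i C = {\<Psi>\<in>C. has_neg i \<Psi> \<and> \<not> has_pos i \<Psi>}"

definition mixed_part :: "nat \<Rightarrow> constraint set \<Rightarrow> constraint set" where
  "mixed_part i C = {\<Psi>\<in>C. has_pos i \<Psi> \<and> has_neg i \<Psi>}"

fun pos_iter :: "nat \<Rightarrow> constraint set \<Rightarrow> nat \<Rightarrow> constraint set" where
  "pos_iter i C 0 = pos_part i C"
| "pos_iter i C (Suc k) = {CPres i \<Psi> \<Psi>' | \<Psi> \<Psi>'. \<Psi> \<in> pos_iter i C k \<and> \<Psi>' \<in> mixed_part i C}"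

definition pos_closure :: "nat \<Rightarrow> constraint set \<Rightarrow> constraint set" where
  "pos_closure i C = (\<Union>k\<in>{0..card (mixed_part i C)}. pos_iter i C k)"

definition eliminate :: "nat \<Rightarrow> constraint set \<Rightarrow> constraint set" where
  "eliminate i C =
     (C - (pos_part i C \<union> neg_part i C \<union> mixed_part i C)) \<union>
     {CPres i \<Psi> \<Psi>' | \<Psi> \<Psi>'. \<Psi> \<in> pos_closure i C \<and> \<Psi>' \<in> neg_part i C}"


section \<open>Basic facts\<close>

lemma satisfies_cong:
  assumes "\<And>\<Psi> k. \<Psi> \<in> C \<Longrightarrow> k \<in> vars \<Psi> \<Longrightarrow> \<alpha> k = \<beta> k"
  shows "satisfies \<alpha> C \<longleftrightarrow> satisfies \<beta> C"
proof -
  have "lin_value \<alpha> e = lin_value \<beta> e" if "\<Psi> \<in> C" "e |\<in>| \<Psi>" for \<Psi> e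
  proof -
    have "\<alpha> k = \<beta> k" if "k \<in> Poly_Mapping.keys (weights e)" for k
      using that \<open>\<Psi> \<in> C\<close> \<open>e |\<in>| \<Psi>\<close> assms[of \<Psi> k] by (auto simp: vars_def in_keys_iff)
    then show ?thesis by (simp add: lin_value_def)
  qed
  then show ?thesis
    unfolding satisfies_def satisfies_constraint_def by metis
qed

lemma weight_lin_minus [simp]: "weight (lin_minus e e') k = weight e k - weight e' k"
  by (simp add: lin_minus_def lookup_minus)

lemma weight_lin_div [simp]: "weight (lin_div e c) k = weight e k / c"
  by (simp add: lin_div_def Poly_Mapping.map.rep_eq when_def)

lemma weight_rest [simp]: "weight (rest i e) k = (if k = i then 0 else weight e k)"
  by (simp add: rest_def lookup_update)

lemma offset_rest [simp]: "offset (rest i e) = offset e"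
  by (simp add: rest_def)

lemma lin_value_eq_rest: "lin_value \<alpha> e = weight e i * \<alpha> i + lin_value \<alpha> (rest i e)"
proof -
  let ?K = "Poly_Mapping.keys (weights e)"
  have keys: "Poly_Mapping.keys (weights (rest i e)) = ?K - {i}"
    by (auto simp: in_keys_iff split: if_splits)
  have "(\<Sum>k\<in>?K. weight e k * \<alpha> k) = weight e i * \<alpha> i + (\<Sum>k\<in>?K - {i}. weight e k * \<alpha> k)"
    by (cases "i \<in> ?K") (simp_all add: sum.remove in_keys_iff)
  also have "(\<Sum>k\<in>?K - {i}. weight e k * \<alpha> k) = (\<Sum>k\<in>?K - {i}. weight (rest i e) k * \<alpha> k)"
    by (intro sum.cong) auto
  finally show ?thesis
    by (simp add: lin_value_def keys)
qed

lemma in_CPres_iff: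
  "e |\<in>| CPres i \<Psi> \<Psi>' \<longleftrightarrow>
     (\<exists>p q. p |\<in>| \<Psi> \<and> occurs_pos i p \<and> q |\<in>| \<Psi>' \<and> occurs_neg i q \<and>
        e = lin_minus (lin_div (rest i p) (weight p i)) (lin_div (rest i q) (weight q i)))
     \<or> (e |\<in>| \<Psi> \<and> \<not> occurs_pos i e) \<or> (e |\<in>| \<Psi>' \<and> \<not> occurs_neg i e)"
  by (auto simp: CPres_def ffUnion.rep_eq)

lemma vars_CPres: "vars (CPres i \<Psi> \<Psi>') \<subseteq> vars \<Psi> \<union> vars \<Psi>'"
proof
  fix k assume "k \<in> vars (CPres i \<Psi> \<Psi>')"
  then obtain e where e: "e |\<in>| CPres i \<Psi> \<Psi>'" "weight e k \<noteq> 0"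
    by (auto simp: vars_def)
  from e(1)[unfolded in_CPres_iff] show "k \<in> vars \<Psi> \<union> vars \<Psi>'"
  proof (elim disjE exE conjE)
    fix p q
    assume pq: "p |\<in>| \<Psi>" "q |\<in>| \<Psi>'"
      "e = lin_minus (lin_div (rest i p) (weight p i)) (lin_div (rest i q) (weight q i))"
    with e(2) have "weight p k \<noteq> 0 \<or> weight q k \<noteq> 0"
      by (auto split: if_splits)
    with pq show ?thesis by (auto simp: vars_def)
  qed (use e(2) in \<open>auto simp: vars_def\<close>)
qed

lemma has_neg_CPres: "\<not> has_neg i \<Psi> \<Longrightarrow> \<not> has_neg i (CPres i \<Psi> \<Psi>')"
  by (auto simp: has_neg_def in_CPres_iff occurs_neg_def)

lemma has_pos_CPres: "\<not> has_pos i \<Psi>' \<Longrightarrow> \<not> has_pos i (CPres i \<Psi> \<Psi>')"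
  by (auto simp: has_pos_def in_CPres_iff occurs_pos_def)

lemma has_pos_CPres_mixed: "has_pos i \<Psi>' \<Longrightarrow> has_pos i (CPres i \<Psi> \<Psi>')"
  unfolding has_pos_def in_CPres_iff occurs_pos_def occurs_neg_def
  by (meson less_asym)

lemma pos_iter_has_pos_not_neg: "\<Psi> \<in> pos_iter i C k \<Longrightarrow> has_pos i \<Psi> \<and> \<not> has_neg i \<Psi>"
  by (induction k arbitrary: \<Psi>)
    (auto simp: pos_part_def mixed_part_def has_neg_CPres has_pos_CPres_mixed)

lemma not_in_vars_iff: "i \<notin> vars \<Psi> \<longleftrightarrow> \<not> has_pos i \<Psi> \<and> \<not> has_neg i \<Psi>"
  unfolding vars_def has_pos_def has_neg_def occurs_pos_def occurs_neg_def
  by (auto simp: neq_iff)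

lemma vars_eliminate:
  assumes "\<And>\<Psi>. \<Psi> \<in> C \<Longrightarrow> vars \<Psi> \<subseteq> {1..i}" and "\<Psi> \<in> eliminate i C"
  shows "vars \<Psi> \<subseteq> {1..<i}"
proof -
  have it: "vars \<Psi> \<subseteq> {1..i}" if "\<Psi> \<in> pos_iter i C k" for \<Psi> k
    using that
  proof (induction k arbitrary: \<Psi>)
    case 0
    then show ?case using assms(1) by (simp add: pos_part_def)
  next
    case (Suc k)
    then obtain \<Psi>1 \<Psi>2 where "\<Psi> = CPres i \<Psi>1 \<Psi>2" "\<Psi>1 \<in> pos_iter i C k" "\<Psi>2 \<in> C"
      by (auto simp: mixed_part_def)
    then show ?case
      using vars_CPres[of i \<Psi>1 \<Psi>2] Suc.IH[of \<Psi>1] assms(1)[of \<Psi>2] by blast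
  qed
  from assms(2) have "vars \<Psi> \<subseteq> {1..i} \<and> i \<notin> vars \<Psi>"
    unfolding eliminate_def
  proof
    assume "\<Psi> \<in> C - (pos_part i C \<union> neg_part i C \<union> mixed_part i C)"
    then show ?thesis
      using assms(1)[of \<Psi>]
      unfolding not_in_vars_iff pos_part_def neg_part_def mixed_part_def by blast
  next
    assume "\<Psi> \<in> {CPres i \<Psi> \<Psi>' | \<Psi> \<Psi>'. \<Psi> \<in> pos_closure i C \<and> \<Psi>' \<in> neg_part i C}"
    then obtain \<Psi>1 \<Psi>2 k where "\<Psi> = CPres i \<Psi>1 \<Psi>2" "\<Psi>1 \<in> pos_iter i C k"
      "\<Psi>2 \<in> C" "\<not> has_pos i \<Psi>2"
      unfolding pos_closure_def neg_part_def by blast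
    moreover have "vars \<Psi>1 \<subseteq> {1..i}" "vars \<Psi>2 \<subseteq> {1..i}" "\<not> has_neg i \<Psi>1"
      using \<open>\<Psi>1 \<in> pos_iter i C k\<close> \<open>\<Psi>2 \<in> C\<close> it assms(1) pos_iter_has_pos_not_neg by blast+
    ultimately show ?thesis
      using vars_CPres[of i \<Psi>1 \<Psi>2] has_pos_CPres[of i \<Psi>2 \<Psi>1] has_neg_CPres[of i \<Psi>1 \<Psi>2]
      unfolding not_in_vars_iff by blast
  qed
  then show ?thesis
    using atLeastLessThan_eq_atLeastAtMost_diff[of 1 i] by blast
qed

end

theory Submission
  imports Defs
begin

text \<open>
  Fix the values of all variables except \<open>x\<^sub>i\<close> and discard the constraints that a disjunct
  without \<open>x\<^sub>i\<close> satisfies.  A remaining constraint reads \<open>x\<^sub>i \<ge> l\<close>, \<open>x\<^sub>i \<le> u\<close> or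
  \<open>x\<^sub>i \<le> u \<or> x\<^sub>i \<ge> l\<close>.  Resolving \<open>x\<^sub>i \<ge> l\<close> with a mixed constraint that \<open>l\<close> violates
  gives the larger lower bound of the mixed constraint, which is satisfied from then on.  So along
  such a chain no mixed constraint is used twice, and at most \<open>|\<Pi>\<^sub>i\<^sup>\<plusminus>|\<close> rounds are needed
  to reach a largest lower bound.  This bound is the value for \<open>x\<^sub>i\<close>: it satisfies the constraints
  \<open>x\<^sub>i \<le> u\<close> because its resolvents with them belong to \<open>\<Pi>\<^bsub>i-1\<^esub>\<close>.
\<close>

section \<open>Evaluation of quotients and differences of linear expressions\<close>

lemma lin_value_superset:
  assumes "finite K" "Poly_Mapping.keys (weights e) \<subseteq> K"
  shows "lin_value \<alpha> e = (\<Sum>k\<in>K. weight e k * \<alpha> k) + offset e"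
  unfolding lin_value_def
  using assms by (auto intro!: sum.mono_neutral_left simp: in_keys_iff)

lemma lin_value_lin_div: "lin_value \<alpha> (lin_div e c) = lin_value \<alpha> e / c"
proof -
  let ?K = "Poly_Mapping.keys (weights e)"
  have "Poly_Mapping.keys (weights (lin_div e c)) \<subseteq> ?K"
    by (auto simp: in_keys_iff)
  then have "lin_value \<alpha> (lin_div e c) = (\<Sum>k\<in>?K. weight e k / c * \<alpha> k) + offset e / c"
    by (subst lin_value_superset[of ?K]) (simp_all, simp add: lin_div_def)
  then show ?thesis
    by (simp add: lin_value_def add_divide_distrib sum_divide_distrib)
qed

lemma lin_value_lin_minus: "lin_value \<alpha> (lin_minus e e') = lin_value \<alpha> e - lin_value \<alpha> e'"
proof -
  \<comment> \<open>Cancellation may shrink the support of the difference, so all three values are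
    summed over one common set.\<close>
  let ?K = "Poly_Mapping.keys (weights e) \<union> Poly_Mapping.keys (weights e')"
  have "Poly_Mapping.keys (weights (lin_minus e e')) \<subseteq> ?K"
    by (auto simp: in_keys_iff)
  moreover have "offset (lin_minus e e') = offset e - offset e'"
    by (simp add: lin_minus_def)
  ultimately show ?thesis
    using lin_value_superset[of ?K e \<alpha>] lin_value_superset[of ?K e' \<alpha>]
      lin_value_superset[of ?K "lin_minus e e'" \<alpha>]
    by (simp add: left_diff_distrib sum_subtractf)
qed

lemma lin_value_rest_upd [simp]: "lin_value (\<alpha>(i := v)) (rest i e) = lin_value \<alpha> (rest i e)"
  unfolding lin_value_def by (auto intro!: sum.cong simp: in_keys_iff split: if_splits)

lemma lin_value_upd: "lin_value (\<alpha>(i := v)) e = weight e i * v + lin_value \<alpha> (rest i e)"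
  using lin_value_eq_rest[of "\<alpha>(i := v)" e i] by simp

section \<open>Reduction to conditions on a single real value\<close>

text \<open>The value of \<open>x\<^sub>i\<close> at which \<open>e\<close> vanishes; meaningful only if \<open>x\<^sub>i\<close> occurs in \<open>e\<close>.\<close>

definition threshold :: "assignment \<Rightarrow> nat \<Rightarrow> lin \<Rightarrow> real" where
  "threshold \<alpha> i e = - lin_value \<alpha> (rest i e) / weight e i"

text \<open>Independent of \<open>\<alpha> i\<close>, since only disjuncts without the variable
  count. If it holds, the constraint imposes nothing on the value of variable
  \<open>i\<close>.\<close>

definition satisfied_without :: "assignment \<Rightarrow> nat \<Rightarrow> constraint \<Rightarrow> bool" where
  "satisfied_without \<alpha> i \<Psi> \<longleftrightarrow> (\<exists>e. e |\<in>| \<Psi> \<and> weight e i = 0 \<and> lin_value \<alpha> e \<ge> 0)"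

lemma lin_value_upd_nonneg_pos:
  "occurs_pos i e \<Longrightarrow> lin_value (\<alpha>(i := v)) e \<ge> 0 \<longleftrightarrow> threshold \<alpha> i e \<le> v"
  by (auto simp: lin_value_upd threshold_def occurs_pos_def field_simps)

lemma lin_value_upd_nonneg_neg:
  "occurs_neg i e \<Longrightarrow> lin_value (\<alpha>(i := v)) e \<ge> 0 \<longleftrightarrow> v \<le> threshold \<alpha> i e"
  by (auto simp: lin_value_upd threshold_def occurs_neg_def field_simps)

lemma lin_value_upd_absent: "weight e i = 0 \<Longrightarrow> lin_value (\<alpha>(i := v)) e = lin_value \<alpha> e"
  using lin_value_eq_rest[of \<alpha> e i] by (simp add: lin_value_upd)

text \<open>The sign of the weight decides whether a disjunct is constant in \<open>v\<close>, a
  lower bound on \<open>v\<close> or an upper bound on \<open>v\<close>.\<close>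

lemma satisfies_constraint_upd_iff:
  "satisfies_constraint (\<alpha>(i := v)) \<Psi> \<longleftrightarrow>
     satisfied_without \<alpha> i \<Psi>
     \<or> (\<exists>e. e |\<in>| \<Psi> \<and> occurs_pos i e \<and> threshold \<alpha> i e \<le> v)
     \<or> (\<exists>e. e |\<in>| \<Psi> \<and> occurs_neg i e \<and> v \<le> threshold \<alpha> i e)"
proof -
  have "lin_value (\<alpha>(i := v)) e \<ge> 0 \<longleftrightarrow>
      weight e i = 0 \<and> lin_value \<alpha> e \<ge> 0
      \<or> occurs_pos i e \<and> threshold \<alpha> i e \<le> v \<or> occurs_neg i e \<and> v \<le> threshold \<alpha> i e" for e
    using lin_value_upd_nonneg_pos[of i e \<alpha> v] lin_value_upd_nonneg_neg[of i e \<alpha> v]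
      lin_value_upd_absent[of e i \<alpha> v]
    by (cases "weight e i" "0 :: real" rule: linorder_cases)
      (auto simp: occurs_pos_def occurs_neg_def)
  then show ?thesis
    unfolding satisfies_constraint_def satisfied_without_def by blast
qed

text \<open>For \<open>p\<close> positive and \<open>q\<close> negative in \<open>i\<close>, the
  resolvent thus says that the lower bound from \<open>p\<close> is at most the upper bound from
  \<open>q\<close>, as in Fourier-Motzkin elimination.\<close>

lemma lin_value_resolvent:
  "lin_value \<alpha> (lin_minus (lin_div (rest i p) (weight p i)) (lin_div (rest i q) (weight q i)))
     = threshold \<alpha> i q - threshold \<alpha> i p"
  by (simp add: lin_value_lin_minus lin_value_lin_div threshold_def)

section \<open>Soundness of resolution and elimination\<close>

lemma satisfies_constraint_CPres:
  assumes "satisfies_constraint \<alpha> \<Psi>" "satisfies_constraint \<alpha> \<Psi>'"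
  shows "satisfies_constraint \<alpha> (CPres i \<Psi> \<Psi>')"
proof -
  obtain p q where p: "p |\<in>| \<Psi>" "lin_value \<alpha> p \<ge> 0" and q: "q |\<in>| \<Psi>'" "lin_value \<alpha> q \<ge> 0"
    using assms by (auto simp: satisfies_constraint_def)
  show ?thesis
  proof (cases "occurs_pos i p \<and> occurs_neg i q")
    case True
    then have "threshold \<alpha> i p \<le> \<alpha> i" "\<alpha> i \<le> threshold \<alpha> i q"
      \<comment> \<open>Updating with the present value \<open>\<alpha> i\<close> changes nothing,
        so the facts about updates apply to \<open>\<alpha>\<close> itself.\<close>
      using p q lin_value_upd_nonneg_pos[of i p \<alpha> "\<alpha> i"] lin_value_upd_nonneg_neg[of i q \<alpha> "\<alpha> i"]
      by auto
    then have "lin_value \<alpha> (lin_minus (lin_div (rest i p) (weight p i))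
        (lin_div (rest i q) (weight q i))) \<ge> 0"
      by (simp add: lin_value_resolvent)
    then show ?thesis
      using True p q unfolding satisfies_constraint_def in_CPres_iff by blast
  next
    case False
    then show ?thesis
      using p q unfolding satisfies_constraint_def in_CPres_iff by blast
  qed
qed

lemma satisfies_eliminate:
  assumes "satisfies \<alpha> C"
  shows "satisfies \<alpha> (eliminate i C)"
proof -
  have "satisfies \<alpha> (pos_iter i C k)" for k
    using assms
    by (induction k)
      (auto simp: satisfies_def pos_part_def mixed_part_def intro!: satisfies_constraint_CPres)
  then show ?thesis
    using assms unfolding satisfies_def eliminate_def pos_closure_def neg_part_def
    by (auto intro!: satisfies_constraint_CPres)
qed

text \<open>Ensures that a greatest lower bound among the derived constraints is attained.\<close>

lemma finite_pos_iter: "finite C \<Longrightarrow> finite (pos_iter i C k)"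
proof (induction k)
  case 0
  then show ?case by (simp add: pos_part_def)
next
  case (Suc k)
  have "pos_iter i C (Suc k) = (\<lambda>(\<Psi>, \<Psi>'). CPres i \<Psi> \<Psi>') ` (pos_iter i C k \<times> mixed_part i C)"
    by auto
  with Suc show ?case by (simp add: mixed_part_def)
qed

section \<open>Lower bounds and their behaviour under resolution\<close>

text \<open>The minimum of an empty set, hence meaningless, unless \<open>has_pos i \<Psi>\<close>.\<close>

definition lower_bound :: "assignment \<Rightarrow> nat \<Rightarrow> constraint \<Rightarrow> real" where
  "lower_bound \<alpha> i \<Psi> = Min (threshold \<alpha> i ` {e. e |\<in>| \<Psi> \<and> occurs_pos i e})"

lemma lower_bound_le_iff:
  assumes "has_pos i \<Psi>"
  shows "lower_bound \<alpha> i \<Psi> \<le> v \<longleftrightarrow> (\<exists>e. e |\<in>| \<Psi> \<and> occurs_pos i e \<and> threshold \<alpha> i e \<le> v)"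
proof -
  have "finite {e. e |\<in>| \<Psi> \<and> occurs_pos i e}"
    by (rule finite_subset[of _ "fset \<Psi>"]) auto
  then show ?thesis
    using assms unfolding lower_bound_def has_pos_def by (subst Min_le_iff) auto
qed

lemma lower_bound_gt:
  assumes "has_pos i \<Psi>" "\<And>e. e |\<in>| \<Psi> \<Longrightarrow> occurs_pos i e \<Longrightarrow> v < threshold \<alpha> i e"
  shows "v < lower_bound \<alpha> i \<Psi>"
  using assms lower_bound_le_iff[of i \<Psi> \<alpha> v] by (meson not_le)

text \<open>A true resolvent disjunct places an upper threshold of \<open>\<Psi>'\<close> at or
  above the lower bound. A true leftover from \<open>\<Psi>\<close> is excluded, and one from
  \<open>\<Psi>'\<close> lacks the variable and survives the update.\<close>

lemma satisfied_CPres_pos_cases: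
  assumes "satisfies_constraint \<alpha> (CPres i \<Psi> \<Psi>')"
    and "has_pos i \<Psi>" "\<not> has_neg i \<Psi>" "\<not> has_pos i \<Psi>'" "\<not> satisfied_without \<alpha> i \<Psi>"
  shows "satisfies_constraint (\<alpha>(i := lower_bound \<alpha> i \<Psi>)) \<Psi>'"
proof -
  obtain e where e: "e |\<in>| CPres i \<Psi> \<Psi>'" "lin_value \<alpha> e \<ge> 0"
    using assms(1) by (auto simp: satisfies_constraint_def)
  from e(1)[unfolded in_CPres_iff] show ?thesis
  proof (elim disjE exE conjE)
    fix p q
    assume pq: "p |\<in>| \<Psi>" "occurs_pos i p" "q |\<in>| \<Psi>'" "occurs_neg i q"
      "e = lin_minus (lin_div (rest i p) (weight p i)) (lin_div (rest i q) (weight q i))"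
    have "lower_bound \<alpha> i \<Psi> \<le> threshold \<alpha> i p"
      using lower_bound_le_iff[OF assms(2)] pq(1,2) by blast
    also have "\<dots> \<le> threshold \<alpha> i q"
      using e(2) pq(5) by (simp add: lin_value_resolvent)
    finally show ?thesis
      using pq unfolding satisfies_constraint_upd_iff by blast
  next
    assume "e |\<in>| \<Psi>" "\<not> occurs_pos i e"
    then have "satisfied_without \<alpha> i \<Psi>"
      using assms(3) e(2) unfolding satisfied_without_def has_neg_def occurs_pos_def occurs_neg_def
      by (metis less_linear)
    with assms(5) show ?thesis by blast
  next
    assume "e |\<in>| \<Psi>'" "\<not> occurs_neg i e"
    then have "satisfied_without \<alpha> i \<Psi>'"
      using assms(4) e(2) unfolding satisfied_without_def has_pos_def occurs_pos_def occurs_neg_def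
      by (metis less_linear)
    then show ?thesis
      unfolding satisfies_constraint_upd_iff by blast
  qed
qed

text \<open>Violation puts all negative thresholds of \<open>\<Psi>'\<close> below the bound of
  \<open>\<Psi>\<close> and all positive ones above it. The final equality allows the mixed
  constraints used along a chain to be counted.\<close>

lemma CPres_mixed_violated:
  assumes "has_pos i \<Psi>" "\<not> has_neg i \<Psi>" "\<not> satisfied_without \<alpha> i \<Psi>" "has_pos i \<Psi>'"
    and viol: "\<not> satisfies_constraint (\<alpha>(i := lower_bound \<alpha> i \<Psi>)) \<Psi>'"
  shows "\<not> satisfied_without \<alpha> i (CPres i \<Psi> \<Psi>')"
    and "lower_bound \<alpha> i \<Psi> < lower_bound \<alpha> i (CPres i \<Psi> \<Psi>')"
    and "lower_bound \<alpha> i (CPres i \<Psi> \<Psi>') = lower_bound \<alpha> i \<Psi>'"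
proof -
  have free: "\<not> satisfied_without \<alpha> i \<Psi>'"
    and above: "\<And>e. e |\<in>| \<Psi>' \<Longrightarrow> occurs_pos i e \<Longrightarrow> lower_bound \<alpha> i \<Psi> < threshold \<alpha> i e"
    and below: "\<And>e. e |\<in>| \<Psi>' \<Longrightarrow> occurs_neg i e \<Longrightarrow> threshold \<alpha> i e < lower_bound \<alpha> i \<Psi>"
    using viol unfolding satisfies_constraint_upd_iff by force+
  show "\<not> satisfied_without \<alpha> i (CPres i \<Psi> \<Psi>')"
  proof
    assume "satisfied_without \<alpha> i (CPres i \<Psi> \<Psi>')"
    then obtain e where e: "e |\<in>| CPres i \<Psi> \<Psi>'" "weight e i = 0" "lin_value \<alpha> e \<ge> 0"
      by (auto simp: satisfied_without_def)
    from e(1)[unfolded in_CPres_iff] show False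
    proof (elim disjE exE conjE)
      fix p q
      assume pq: "p |\<in>| \<Psi>" "occurs_pos i p" "q |\<in>| \<Psi>'" "occurs_neg i q"
        "e = lin_minus (lin_div (rest i p) (weight p i)) (lin_div (rest i q) (weight q i))"
      have "lower_bound \<alpha> i \<Psi> \<le> threshold \<alpha> i p"
        using lower_bound_le_iff[OF assms(1)] pq(1,2) by blast
      also have "\<dots> \<le> threshold \<alpha> i q"
        using e(3) pq(5) by (simp add: lin_value_resolvent)
      finally show False
        using below[OF pq(3,4)] by simp
    qed (use e assms(3) free in \<open>auto simp: satisfied_without_def\<close>)
  qed
  \<comment> \<open>The positive disjuncts of \<open>\<Psi>\<close> are resolved away, resolvents
    lack the variable, and those of \<open>\<Psi>'\<close> are kept.\<close>
  have "{e. e |\<in>| CPres i \<Psi> \<Psi>' \<and> occurs_pos i e} = {e. e |\<in>| \<Psi>' \<and> occurs_pos i e}"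
    by (auto simp: in_CPres_iff occurs_pos_def occurs_neg_def)
  then show eq: "lower_bound \<alpha> i (CPres i \<Psi> \<Psi>') = lower_bound \<alpha> i \<Psi>'"
    by (simp add: lower_bound_def)
  show "lower_bound \<alpha> i \<Psi> < lower_bound \<alpha> i (CPres i \<Psi> \<Psi>')"
    unfolding eq using assms(4) above by (rule lower_bound_gt)
qed

section \<open>Extending an assignment by a value for the eliminated variable\<close>

lemma satisfied_without_if_not_occurs:
  assumes "satisfies \<alpha> (eliminate i C)" "\<Psi> \<in> C" "\<not> has_pos i \<Psi>" "\<not> has_neg i \<Psi>"
  shows "satisfied_without \<alpha> i \<Psi>"
proof -
  have "\<Psi> \<in> eliminate i C"
    using assms(2-4) by (simp add: eliminate_def pos_part_def neg_part_def mixed_part_def)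
  then have "satisfies_constraint \<alpha> \<Psi>"
    using assms(1) by (simp add: satisfies_def)
  moreover have "i \<notin> vars \<Psi>"
    using assms(3,4) by (simp add: not_in_vars_iff)
  ultimately show ?thesis
    by (auto simp: satisfied_without_def satisfies_constraint_def vars_def)
qed

text \<open>A value below the finitely many thresholds makes every negative disjunct true.\<close>

lemma extension_without_lower_bounds:
  assumes "finite C" "\<And>\<Psi>. \<Psi> \<in> C \<Longrightarrow> has_neg i \<Psi> \<or> satisfied_without \<alpha> i \<Psi>"
  shows "\<exists>v. satisfies (\<alpha>(i := v)) C"
proof -
  have "finite (\<Union>\<Psi>\<in>C. threshold \<alpha> i ` fset \<Psi>)"
    using assms(1) by auto
  then have "bdd_below (\<Union>\<Psi>\<in>C. threshold \<alpha> i ` fset \<Psi>)"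
    by (rule bdd_below_finite)
  then obtain v where "\<And>\<Psi> e. \<Psi> \<in> C \<Longrightarrow> e |\<in>| \<Psi> \<Longrightarrow> v \<le> threshold \<alpha> i e"
    unfolding bdd_below_def by blast
  then have "satisfies (\<alpha>(i := v)) C"
    using assms(2) unfolding satisfies_def satisfies_constraint_upd_iff has_neg_def by blast
  then show ?thesis ..
qed

text \<open>\<open>T\<close> admits a constraint from round \<open>k\<close> only if its bound has
  reached at least \<open>k\<close> mixed constraints. This keeps \<open>T\<close> inside
  \<open>pos_closure\<close>, yet resolving with a violated mixed constraint stays in
  \<open>T\<close>, so the greatest bound violates none.\<close>

lemma extension_at_greatest_lower_bound:
  fixes C :: "constraint set" and \<alpha> :: assignment and i :: nat
  defines "reached v \<equiv> {\<Psi>' \<in> mixed_part i C. lower_bound \<alpha> i \<Psi>' \<le> v}"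
  defines "T \<equiv> {\<Psi>. \<not> satisfied_without \<alpha> i \<Psi> \<and>
      (\<exists>k. \<Psi> \<in> pos_iter i C k \<and> k \<le> card (reached (lower_bound \<alpha> i \<Psi>)))}"
  assumes fin: "finite C" and sat: "satisfies \<alpha> (eliminate i C)" and "T \<noteq> {}"
  shows "\<exists>v. satisfies (\<alpha>(i := v)) C"
proof -
  have fin_mixed: "finite (mixed_part i C)"
    using fin by (simp add: mixed_part_def)
  have fin_reached: "finite (reached v)" for v
    using fin_mixed by (simp add: reached_def)
  have card_reached: "card (reached v) \<le> card (mixed_part i C)" for v
    using fin_mixed by (rule card_mono) (simp add: reached_def)
  have T_sub: "T \<subseteq> pos_closure i C"
  proof
    fix \<Phi> assume "\<Phi> \<in> T"
    then obtain k where "\<Phi> \<in> pos_iter i C k" "k \<le> card (reached (lower_bound \<alpha> i \<Phi>))"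
      unfolding T_def by blast
    moreover from this(2) have "k \<le> card (mixed_part i C)"
      using card_reached order_trans by blast
    ultimately show "\<Phi> \<in> pos_closure i C"
      unfolding pos_closure_def by auto
  qed
  have "finite (pos_closure i C)"
    using fin by (simp add: pos_closure_def finite_pos_iter)
  then have "finite T"
    using T_sub finite_subset by blast
  then have "Max (lower_bound \<alpha> i ` T) \<in> lower_bound \<alpha> i ` T"
    using \<open>T \<noteq> {}\<close> by (intro Max_in) auto
  then obtain \<Psi> where \<Psi>: "\<Psi> \<in> T" and max: "Max (lower_bound \<alpha> i ` T) = lower_bound \<alpha> i \<Psi>"
    by blast
  have greatest: "lower_bound \<alpha> i \<Phi> \<le> lower_bound \<alpha> i \<Psi>" if "\<Phi> \<in> T" for \<Phi>
    unfolding max[symmetric] using that \<open>finite T\<close> by (intro Max_ge) auto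
  define v where "v = lower_bound \<alpha> i \<Psi>"
  obtain k where free: "\<not> satisfied_without \<alpha> i \<Psi>" and k: "\<Psi> \<in> pos_iter i C k" "k \<le> card (reached v)"
    using \<Psi> unfolding T_def v_def by blast
  have pos: "has_pos i \<Psi>" "\<not> has_neg i \<Psi>"
    using pos_iter_has_pos_not_neg[OF k(1)] by blast+
  have "satisfies_constraint (\<alpha>(i := v)) \<Psi>'" if "\<Psi>' \<in> C" for \<Psi>'
  proof -
    consider "\<Psi>' \<in> pos_part i C" | "\<Psi>' \<in> neg_part i C" | "\<Psi>' \<in> mixed_part i C"
      | "\<Psi>' \<in> C - (pos_part i C \<union> neg_part i C \<union> mixed_part i C)"
      using \<open>\<Psi>' \<in> C\<close> by blast
    then show ?thesis
    proof cases
      case 1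
      show ?thesis
      proof (cases "satisfied_without \<alpha> i \<Psi>'")
        case False
        \<comment> \<open>Round 0 meets the cardinality condition trivially.\<close>
        have "\<Psi>' \<in> T"
          using 1 False unfolding T_def by (auto intro: exI[of _ 0])
        then show ?thesis
          using greatest[of \<Psi>'] 1 lower_bound_le_iff[of i \<Psi>' \<alpha> v]
          unfolding satisfies_constraint_upd_iff v_def pos_part_def by blast
      qed (simp add: satisfies_constraint_upd_iff)
    next
      case 2
      then have "CPres i \<Psi> \<Psi>' \<in> eliminate i C"
        using \<Psi> T_sub unfolding eliminate_def by blast
      then have "satisfies_constraint \<alpha> (CPres i \<Psi> \<Psi>')"
        using sat by (simp add: satisfies_def)
      then show ?thesis
        unfolding v_def using pos free 2
        by (intro satisfied_CPres_pos_cases) (auto simp: neg_part_def)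
    next
      case 3
      show ?thesis
      proof (rule ccontr)
        assume "\<not> satisfies_constraint (\<alpha>(i := v)) \<Psi>'"
        then have viol: "\<not> satisfies_constraint (\<alpha>(i := lower_bound \<alpha> i \<Psi>)) \<Psi>'"
          by (simp add: v_def)
        define \<Phi> where "\<Phi> = CPres i \<Psi> \<Psi>'"
        have "has_pos i \<Psi>'"
          using 3 by (simp add: mixed_part_def)
        note step = CPres_mixed_violated[OF pos free this viol, folded \<Phi>_def v_def]
        \<comment> \<open>The new element is \<open>\<Psi>'\<close>, whose bound equals that of
          \<open>\<Phi>\<close> and exceeds \<open>v\<close>. This strict growth pays for the extra
          round.\<close>
        have "reached v \<subset> reached (lower_bound \<alpha> i \<Phi>)"
          using step 3 unfolding reached_def by force
        then have "Suc k \<le> card (reached (lower_bound \<alpha> i \<Phi>))"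
          using k(2) psubset_card_mono[OF fin_reached] by (meson Suc_leI le_less_trans)
        moreover have "\<Phi> \<in> pos_iter i C (Suc k)"
          using k(1) 3 by (auto simp: \<Phi>_def)
        ultimately have "\<Phi> \<in> T"
          using step(1) unfolding T_def by blast
        then show False
          using greatest[of \<Phi>] step(2) by (simp add: v_def)
      qed
    next
      case 4
      then have "\<not> has_pos i \<Psi>'" "\<not> has_neg i \<Psi>'"
        unfolding pos_part_def neg_part_def mixed_part_def by blast+
      then have "satisfied_without \<alpha> i \<Psi>'"
        using sat \<open>\<Psi>' \<in> C\<close> by (blast intro: satisfied_without_if_not_occurs)
      then show ?thesis
        by (simp add: satisfies_constraint_upd_iff)
    qed
  qed
  then show ?thesis
    unfolding satisfies_def by blast
qed

text \<open>Either a sufficiently small value works, or some constraint bounds the variable only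
  from below and starts the chain of lower bounds at round 0.\<close>

lemma extension:
  assumes fin: "finite C" and sat: "satisfies \<alpha> (eliminate i C)"
  shows "\<exists>v. satisfies (\<alpha>(i := v)) C"
proof (cases "\<forall>\<Psi>\<in>C. has_neg i \<Psi> \<or> satisfied_without \<alpha> i \<Psi>")
  case True
  with fin show ?thesis
    by (blast intro: extension_without_lower_bounds)
next
  case False
  then obtain \<Psi> where \<Psi>: "\<Psi> \<in> C" "\<not> has_neg i \<Psi>" "\<not> satisfied_without \<alpha> i \<Psi>"
    by blast
  have "has_pos i \<Psi>"
    using satisfied_without_if_not_occurs[OF sat] \<Psi> by blast
  then have "\<Psi> \<in> pos_iter i C 0"
    using \<Psi> by (simp add: pos_part_def)
  then show ?thesis
    using \<Psi>(3) by (intro extension_at_greatest_lower_bound[OF fin sat]) blast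
qed

theorem lemma3p3:
  fixes i :: nat and C :: "constraint set"
  assumes "i \<ge> 1"
    and "finite C"
    and "\<forall>\<Psi>\<in>C. vars \<Psi> \<subseteq> {1..i}"
  shows "equisatisfiable C (eliminate i C) \<and>
    (\<forall>\<alpha>. satisfies \<alpha> (eliminate i C) \<longrightarrow> (\<exists>v. satisfies (\<alpha>(i := v)) C))"
  using satisfies_eliminate extension[OF assms(2)]
  unfolding equisatisfiable_def satisfiable_def by blast

end
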